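(* For all $k,\ell\in\mathbb{N}$, the following relations hold in $\mathbb{V}$: $$xC^{s}_{k+\ell+1}=\frac{(xC^{s}_{\ell})\star(xC^{s}_ky)-(xC^{s}_ky)\star(xC^{s}_{\ell})}{q+q^{-1}},$$ $$C^{s}_{k+\ell+1}y=\frac{(xC^{s}_ky)\star(C^{s}_{\ell}y)-(C^{s}_{\ell}y)\star(xC^{s}_ky)}{q+q^{-1}}.$$
   Context: Ground field $\mathbb{F}=\mathbb{Q}(q)$, $q$ an indeterminate; $\mathbb{N}=\{0,1,2,\ldots\}$; $\{n\}_q=\frac{q^{-n}-(-1)^nq^n}{q+q^{-1}}$. $\mathbb{V}$ is the free associative unital $\mathbb{F}$-algebra on noncommuting $x,y$; words form a basis; the empty word is $1$; juxtaposition denotes concatenation. The $q$-shuffle superproduct $\star$ is the bilinear associative product on $\mathbb{V}$ with $1\star v=v\star1=v$ and, for nontrivial words $u=u_1\cdots u_r$, $v=v_1\cdots v_s$, recursively $$u\star v=u_1\big((u_2\cdots u_r)\star v\big)+(-1)^r v_1\big(u\star(v_2\cdots v_s)\big)q^{\langle u_1,v_1\rangle+\cdots+\langle u_r,v_1\rangle},$$ where $\langle x,x\rangle=\langle y,y\rangle=2$, $\langle x,y\rangle=\langle y,x\rangle=-2$. Catalan elements: put $\bar x=1$, $\bar y=-1$. A word $a_1\cdots a_m$ is Catalan if $\bar a_1+\cdots+\bar a_m=0$ and $\bar a_1+\cdots+\bar a_i\ge0$ for all $1\le i\le m$. $\mathrm{Cat}_n$ is the set of Catalan words of length $2n$. Define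 $C^s(1)=1$, and for $n\ge1$, $w\in\mathrm{Cat}_n$, $$C^{s}(w)=\sum_{v\in\mathrm{Cat}_{n-1}}C^{s}(v)\sum_i(-1)^i\{2+2\bar a_1+\cdots+2\bar a_i\}_q,$$ where, for $v=a_1\cdots a_m$ ($m=2n-2$), the inner sum is over the $i$, $0\le i\le m$, such that $w=a_1\cdots a_i\,x\,a_{i+1}\cdots a_m\,y$. Set $C^{s}_n=\sum_{w\in\mathrm{Cat}_n}C^s(w)\,w\in\mathbb{V}$ (so $C^s_0=1$, $C^s_1=\{2\}_qxy$). $xC^s_n$, $C^s_ny$, $xC^s_ny$ are concatenation products. *)

theory Defs
  imports
    "HOL-Computational_Algebra.Fraction_Field"
    "HOL-Computational_Algebra.Polynomial"
    "HOL-Library.Poly_Mapping"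
begin

datatype letter = X | Y

type_synonym word = "letter list"

type_synonym scalar = "rat poly fract"

definition q :: scalar where
  "q = Fraction_Field.Fract [:0, 1:] 1"

lemma q_nonzero: "q \<noteq> 0"
  by (simp add: q_def Zero_fract_def eq_fract)

lemma q_plus_inverse_nonzero: "q + inverse q \<noteq> 0"
  by (simp add: q_def Zero_fract_def eq_fract one_pCons)

text \<open>
  With concatenation as addition, lists form the free monoid, so the convolution
  product on finitely supported functions on words is the concatenation product
  and \<open>free_alg\<close> is the free associative unital algebra, with unit the empty word.
\<close>

instantiation list :: (type) monoid_add
begin

definition zero_list :: "'a list" where
  "zero_list = []"

definition plus_list :: "'a list \<Rightarrow> 'a list \<Rightarrow> 'a list" where
  "plus_list u v = u @ v"

instance
  by standard (simp_all add: zero_list_def plus_list_def)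

end

type_synonym free_alg = "word \<Rightarrow>\<^sub>0 scalar"

definition scale :: "scalar \<Rightarrow> free_alg \<Rightarrow> free_alg"  (infixr \<open>\<odot>\<close> 75) where
  "c \<odot> v = Poly_Mapping.map ((*) c) v"

definition of_word :: "word \<Rightarrow> free_alg" where
  "of_word w = Poly_Mapping.single w 1"

abbreviation gen_x :: free_alg  (\<open>\<x>\<close>) where "\<x> \<equiv> of_word [X]"

abbreviation gen_y :: free_alg  (\<open>\<y>\<close>) where "\<y> \<equiv> of_word [Y]"

lemma lookup_scale [simp]: "Poly_Mapping.lookup (c \<odot> v) w = c * Poly_Mapping.lookup v w"
  by (simp add: scale_def Poly_Mapping.map.rep_eq when_def)

lemma of_word_Nil: "of_word [] = 1"
  by (simp add: of_word_def zero_list_def flip: single_one)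

lemma of_word_append: "of_word (u @ v) = of_word u * of_word v"
  by (simp add: of_word_def mult_single plus_list_def)

fun form :: "letter \<Rightarrow> letter \<Rightarrow> int" where
  "form X X = 2"
| "form Y Y = 2"
| "form X Y = -2"
| "form Y X = -2"

fun shuffle_word :: "word \<Rightarrow> word \<Rightarrow> free_alg" where
  "shuffle_word [] v = of_word v"
| "shuffle_word (a # u) [] = of_word (a # u)"
| "shuffle_word (a # u) (b # v) =
     of_word [a] * shuffle_word u (b # v)
     + ((-1) ^ length (a # u) * q powi (\<Sum>c\<leftarrow>a # u. form c b))
         \<odot> (of_word [b] * shuffle_word (a # u) v)"

definition star :: "free_alg \<Rightarrow> free_alg \<Rightarrow> free_alg"  (infixl \<open>\<star>\<close> 70) where
  "f \<star> g = (\<Sum>u\<in>Poly_Mapping.keys f. \<Sum>v\<in>Poly_Mapping.keys g.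
     (Poly_Mapping.lookup f u * Poly_Mapping.lookup g v) \<odot> shuffle_word u v)"

lemma star_of_word: "of_word u \<star> of_word v = shuffle_word u v"
  by (rule poly_mapping_eqI) (simp add: star_def of_word_def)

definition qbracket :: "int \<Rightarrow> scalar" where
  "qbracket n = (q powi (-n) - (-1) powi n * q powi n) / (q + inverse q)"

fun wt :: "letter \<Rightarrow> int" where
  "wt X = 1"
| "wt Y = -1"

definition height :: "word \<Rightarrow> int" where
  "height w = (\<Sum>a\<leftarrow>w. wt a)"

definition catalan :: "word \<Rightarrow> bool" where
  "catalan w \<longleftrightarrow> height w = 0 \<and> (\<forall>i\<in>{1..length w}. height (take i w) \<ge> 0)"

definition Cat :: "nat \<Rightarrow> word set" where
  "Cat n = {w. catalan w \<and> length w = 2 * n}"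

lemma finite_Cat: "finite (Cat n)"
proof -
  have "finite (UNIV :: letter set)"
    by (rule finite_subset[of _ "{X, Y}"]) (auto, metis letter.exhaust)
  then have "finite {w :: word. set w \<subseteq> UNIV \<and> length w = 2 * n}"
    by (rule finite_lists_length_eq)
  then show ?thesis
    by (rule finite_subset[rotated]) (auto simp: Cat_def)
qed

text \<open>\<open>Cs_coeff n w\<close> is only meaningful for \<open>w \<in> Cat n\<close>.\<close>

fun Cs_coeff :: "nat \<Rightarrow> word \<Rightarrow> scalar" where
  "Cs_coeff 0 w = 1"
| "Cs_coeff (Suc n) w =
     (\<Sum>v\<in>Cat n. Cs_coeff n v *
        (\<Sum>i\<in>{i. i \<le> length v \<and> w = take i v @ [X] @ drop i v @ [Y]}.
           (-1) ^ i * qbracket (2 + 2 * height (take i v))))"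

definition Cs :: "nat \<Rightarrow> free_alg" where
  "Cs n = (\<Sum>w\<in>Cat n. Cs_coeff n w \<odot> of_word w)"

lemma Cs_0: "Cs 0 = 1"
proof -
  have "Cat 0 = {[]}"
    by (auto simp: Cat_def catalan_def height_def)
  then show ?thesis
    by (simp add: Cs_def of_word_Nil poly_mapping_eq_iff fun_eq_iff)
qed

end

theory Submission
  imports Defs
begin

text \<open>
  Put \<open>\<tau> = - q\<^sup>2\<close>. Moving a word \<open>u\<close> past a letter \<open>b\<close> in the shuffle superproduct costs the
  factor \<open>\<chi> b u\<close>, which is a power of \<open>\<tau>\<close> with exponent \<open>wt b * height u\<close>. So signs
  need no separate treatment, and passing an element of height \<open>0\<close> costs nothing.

  The proof uses only associativity of \<open>\<star>\<close> and the two rules that split off the first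
  or the last letters of the factors of a product. Write \<open>\<kappa> = q + inverse q\<close> and let
  \<open>ad_xy f\<close> be the commutator of \<open>f\<close> with \<open>\<x> * \<y>\<close>. Consider the operators
  \<open>grow_right v = \<tau> \<odot> (\<x> \<star> (v * \<y>)) - (v * \<y>) \<star> \<x>\<close> and
  \<open>grow_left v = \<tau> \<odot> ((\<x> * v) \<star> \<y>) - \<y> \<star> (\<x> * v)\<close> on elements \<open>v\<close> of height \<open>0\<close>. The
  recursion that defines the Catalan elements says exactly that
  \<open>grow_right (Cs n) = \<kappa> \<odot> Cs (n + 1)\<close>. The heart of the matter is that also
  \<open>grow_left (Cs n) = \<kappa> \<odot> Cs (n + 1)\<close> and \<open>ad_xy (Cs n) = 0\<close>, and these two facts are
  proved together by induction on \<open>n\<close>: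

  \<^item> \<open>grow_right\<close> and \<open>grow_left\<close> commute on \<open>v\<close> up to a multiple of
    \<open>ad_xy (\<x> * v * \<y>)\<close>, because their values are encoded by the commutators of
    \<open>\<x> * v * \<y>\<close> with \<open>\<x>\<close> and with \<open>\<y>\<close>. That obstruction vanishes for
    \<open>v = Cs m\<close> by the induction hypothesis, so the two operators agree on \<open>Cs (m + 1)\<close>,
    the common value of both of them at \<open>Cs m\<close> up to the factor \<open>\<kappa>\<close>.

  \<^item> Where both facts are known, the derivation \<open>ad_xy\<close> maps \<open>\<x> * Cs l\<close> to
    \<open>\<kappa> \<odot> (\<x> * Cs (l + 1))\<close> and \<open>Cs k * \<y>\<close> to \<open>- (\<kappa> \<odot> (Cs (k + 1) * \<y>))\<close>. Hence on the elements
    \<open>cross k l = \<tau> \<odot> ((\<x> * Cs l) \<star> (Cs k * \<y>)) - (Cs k * \<y>) \<star> (\<x> * Cs l)\<close> it acts as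
    \<open>\<kappa> \<odot> (cross k (l + 1) - cross (k + 1) l)\<close>. On each diagonal \<open>k + l = m\<close> that is already
    understood, \<open>cross k l = \<kappa> \<odot> Cs (m + 1)\<close>, so \<open>ad_xy (Cs (m + 1))\<close> is the difference of any
    two neighbours on the next diagonal. The two ends of that diagonal are
    \<open>grow_left (Cs (m + 1))\<close> and \<open>grow_right (Cs (m + 1))\<close>, which agree; so a positive
    multiple of \<open>ad_xy (Cs (m + 1))\<close> vanishes, and the ground field has characteristic \<open>0\<close>.

  Given these facts, \<open>ad_xy\<close> kills \<open>\<x> * Cs k * \<y>\<close>, and both relations follow by applying it
  \<open>l\<close> times to their cases \<open>l = 0\<close>, which compute the commutators of \<open>\<x> * Cs k * \<y>\<close> with
  \<open>\<x>\<close> and \<open>\<y>\<close>.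
\<close>

section \<open>The braiding\<close>

definition \<tau> :: scalar where "\<tau> = - (q ^ 2)"

lemma \<tau>_nonzero: "\<tau> \<noteq> 0"
  by (simp add: \<tau>_def q_nonzero)

lemma \<tau>_powi_add: "\<tau> powi (m + n) = \<tau> powi m * \<tau> powi n"
  by (rule power_int_add) (simp add: \<tau>_nonzero)

text \<open>
  The factor produced when the letter \<open>b\<close> moves to the left past the word \<open>u\<close>; see
  \<open>braiding_factor\<close> below.
\<close>
definition \<chi> :: "letter \<Rightarrow> word \<Rightarrow> scalar" where
  "\<chi> b u = \<tau> powi (wt b * height u)"

lemma height_simps [simp]:
  "height [] = 0" "height (a # u) = wt a + height u" "height (u @ v) = height u + height v"
  by (simp_all add: height_def)

lemma \<chi>_Nil [simp]: "\<chi> b [] = 1"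
  by (simp add: \<chi>_def)

lemma \<chi>_append: "\<chi> b (u @ v) = \<chi> b u * \<chi> b v"
  by (simp add: \<chi>_def distrib_left \<tau>_powi_add)

lemma \<chi>_Cons: "\<chi> b (a # u) = \<chi> b [a] * \<chi> b u"
  using \<chi>_append[of b "[a]" u] by simp

lemma \<chi>_commute: "\<chi> a [b] = \<chi> b [a]"
  by (simp add: \<chi>_def mult.commute)

lemma braiding_factor: "(-1) ^ length u * q powi (\<Sum>c\<leftarrow>u. form c b) = \<chi> b u"
proof (induction u)
  case (Cons a u)
  have step: "- (q powi form a b) = \<chi> b [a]"
    by (cases a; cases b) (auto simp: \<chi>_def \<tau>_def power_int_minus)
  have "(-1) ^ length (a # u) * q powi (\<Sum>c\<leftarrow>a # u. form c b)
      = - (q powi form a b) * ((-1) ^ length u * q powi (\<Sum>c\<leftarrow>u. form c b))"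
    by (simp add: power_int_add q_nonzero)
  also have "\<dots> = \<chi> b (a # u)"
    unfolding Cons step by (rule \<chi>_Cons[symmetric])
  finally show ?case .
qed simp

section \<open>The shuffle product coefficient by coefficient\<close>

text \<open>
  The coefficient of a word in the shuffle product of two formal series, by recursion on that
  word: removing the first letter is a skew derivation of the product. With arbitrary
  functions as arguments, the recursion stays inside one induction on the word, which makes
  bilinearity, associativity and the rule for the last letter short computations.
\<close>
primrec shuf :: "word \<Rightarrow> (word \<Rightarrow> scalar) \<Rightarrow> (word \<Rightarrow> scalar) \<Rightarrow> scalar" where
  "shuf [] f g = f [] * g []"
| "shuf (b # w) f g =
     shuf w (\<lambda>u. f (b # u)) g + shuf w (\<lambda>u. \<chi> b u * f u) (\<lambda>u. g (b # u))"

lemma shuf_add_left: "shuf w (\<lambda>u. f u + f' u) g = shuf w f g + shuf w f' g"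
  by (induction w arbitrary: f f' g) (simp_all add: algebra_simps)

lemma shuf_add_right: "shuf w f (\<lambda>u. g u + g' u) = shuf w f g + shuf w f g'"
  by (induction w arbitrary: f g g') (simp_all add: algebra_simps)

lemma shuf_scale_left: "shuf w (\<lambda>u. c * f u) g = c * shuf w f g"
proof (induction w arbitrary: f g)
  case (Cons b w)
  show ?case
    using Cons[of "\<lambda>u. \<chi> b u * f u"] by (simp add: Cons distrib_left mult.left_commute[of _ c])
qed simp

lemma shuf_scale_right: "shuf w f (\<lambda>u. c * g u) = c * shuf w f g"
  by (induction w arbitrary: f g) (simp_all add: algebra_simps)

lemma shuf_0_left [simp]: "shuf w (\<lambda>u. 0) g = 0"
  using shuf_scale_left[of w 0] by simp

lemma shuf_0_right [simp]: "shuf w f (\<lambda>u. 0) = 0"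
  using shuf_scale_right[of w f 0] by simp

lemma shuf_sum_left:
  "finite A \<Longrightarrow> shuf w (\<lambda>u. \<Sum>i\<in>A. f i u) g = (\<Sum>i\<in>A. shuf w (f i) g)"
  by (induction A rule: finite_induct) (simp_all add: shuf_add_left)

lemma shuf_sum_right:
  "finite A \<Longrightarrow> shuf w f (\<lambda>u. \<Sum>i\<in>A. g i u) = (\<Sum>i\<in>A. shuf w f (g i))"
  by (induction A rule: finite_induct) (simp_all add: shuf_add_right)

text \<open>
  The twist by \<open>\<chi> b\<close> is an algebra endomorphism, because \<open>\<chi> b\<close> is multiplicative under
  concatenation. This is what associativity needs.
\<close>
lemma \<chi>_shuf: "\<chi> b w * shuf w f g = shuf w (\<lambda>u. \<chi> b u * f u) (\<lambda>u. \<chi> b u * g u)"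
proof (induction w arbitrary: f g)
  case (Cons c w)
  have 1: "shuf w (\<lambda>u. \<chi> b (c # u) * f (c # u)) (\<lambda>u. \<chi> b u * g u)
      = \<chi> b [c] * (\<chi> b w * shuf w (\<lambda>u. f (c # u)) g)"
    by (subst \<chi>_Cons) (simp add: Cons shuf_scale_left mult.assoc)
  have 2: "shuf w (\<lambda>u. \<chi> c u * (\<chi> b u * f u)) (\<lambda>u. \<chi> b (c # u) * g (c # u))
      = \<chi> b [c] * (\<chi> b w * shuf w (\<lambda>u. \<chi> c u * f u) (\<lambda>u. g (c # u)))"
    by (subst \<chi>_Cons) (simp add: Cons shuf_scale_right mult.assoc mult.left_commute[of "\<chi> c _"])
  show ?case
    unfolding shuf.simps 1 2 by (simp add: \<chi>_Cons[of b c w] distrib_left mult.assoc)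
qed simp

lemma shuf_assoc: "shuf w (\<lambda>v. shuf v f g) h = shuf w f (\<lambda>v. shuf v g h)"
proof (induction w arbitrary: f g h)
  case (Cons b w)
  show ?case
    by (simp add: shuf_add_left shuf_add_right Cons \<chi>_shuf algebra_simps)
qed (simp add: mult.assoc)

text \<open>
  Removing the last letter is a skew derivation too, with the twist on the other factor: a last
  letter \<open>b\<close> of the left factor has been passed by all of the right factor.
  The induction works because \<open>\<chi>\<close> is symmetric in two letters.
\<close>
lemma shuf_snoc:
  "shuf (w @ [b]) f g =
     shuf w f (\<lambda>u. g (u @ [b])) + shuf w (\<lambda>u. f (u @ [b])) (\<lambda>u. \<chi> b u * g u)"
proof (induction w arbitrary: f g)
  case (Cons c w)
  have "shuf w (\<lambda>u. \<chi> c (u @ [b]) * f (u @ [b])) (\<lambda>u. \<chi> b u * g (c # u)) =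
        shuf w (\<lambda>u. \<chi> c u * f (u @ [b])) (\<lambda>u. \<chi> b (c # u) * g (c # u))"
    by (subst \<chi>_append, subst \<chi>_Cons)
      (simp add: \<chi>_commute[of c b] mult.assoc mult.left_commute[of _ "\<chi> b [c]"]
        shuf_scale_left shuf_scale_right)
  then show ?case
    by (simp add: Cons)
qed simp

section \<open>Transfer to the free algebra\<close>

lemma lookup_of_word: "Poly_Mapping.lookup (of_word u) w = (if w = u then 1 else 0)"
  by (simp add: of_word_def lookup_single when_def)

lemma scale_conv_mult: "c \<odot> f = Poly_Mapping.single 0 c * f"
  by (simp add: scale_def mult_map_scale_conv_mult)

lemma lookup_scale_fun: "Poly_Mapping.lookup (c \<odot> f) = (\<lambda>w. c * Poly_Mapping.lookup f w)"
  by (simp add: fun_eq_iff)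

interpretation free_alg: vector_space scale
  by standard (auto intro!: poly_mapping_eqI simp: lookup_add algebra_simps)

lemma mult_scale_left: "(c \<odot> f) * g = c \<odot> (f * g)"
  by (simp add: scale_conv_mult mult.assoc)

lemma of_word_expansion: "f = (\<Sum>w\<in>Poly_Mapping.keys f. Poly_Mapping.lookup f w \<odot> of_word w)"
  by (rule poly_mapping_eqI) (simp add: lookup_sum lookup_of_word in_keys_iff if_distrib sum.delta cong: if_cong)

lemma free_alg_induct [case_names of_word add]:
  assumes "\<And>c w. P (c \<odot> of_word w)" and "\<And>f g. P f \<Longrightarrow> P g \<Longrightarrow> P (f + g)"
  shows "P f"
proof -
  have "P (\<Sum>w\<in>A. Poly_Mapping.lookup f w \<odot> of_word w)" if "finite A" for A
    using that
  proof (induction A)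
    case empty
    show ?case using assms(1)[of 0] by simp
  qed (simp add: assms)
  then show ?thesis
    using of_word_expansion[of f] by (metis finite_keys)
qed

lemma mult_scale_right: "f * (c \<odot> g) = c \<odot> (f * g)"
proof (induction f rule: free_alg_induct)
  case (of_word d u)
  have "of_word u * (c \<odot> g) = c \<odot> (of_word u * g)"
    by (simp add: scale_conv_mult of_word_def mult_single flip: mult.assoc)
  then show ?case
    by (simp add: mult_scale_left mult.commute)
qed (simp add: distrib_right free_alg.scale_right_distrib)

lemma lookup_of_word_concat [simp]:
  fixes f :: free_alg
  shows "Poly_Mapping.lookup (of_word [a] * f) [] = 0"
    and "Poly_Mapping.lookup (of_word [a] * f) (b # w) = (if a = b then Poly_Mapping.lookup f w else 0)"
proof (induction f rule: free_alg_induct)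
  case (of_word c u)
  { case 1 show ?case by (simp add: mult_scale_right lookup_of_word flip: of_word_append) }
  { case 2 show ?case by (simp add: mult_scale_right lookup_of_word flip: of_word_append) }
next
  case (add f g)
  { case 1 with add show ?case by (simp add: distrib_left lookup_add) }
  { case 2 with add show ?case by (simp add: distrib_left lookup_add) }
qed

lemma lookup_concat_of_word [simp]:
  fixes f :: free_alg
  shows "Poly_Mapping.lookup (f * of_word [a]) [] = 0"
    and "Poly_Mapping.lookup (f * of_word [a]) (w @ [b]) = (if a = b then Poly_Mapping.lookup f w else 0)"
proof (induction f rule: free_alg_induct)
  case (of_word c u)
  { case 1 show ?case by (simp add: mult_scale_left lookup_of_word flip: of_word_append) }
  { case 2 show ?case by (simp add: mult_scale_left lookup_of_word flip: of_word_append) }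
next
  case (add f g)
  { case 1 with add show ?case by (simp add: distrib_right lookup_add) }
  { case 2 with add show ?case by (simp add: distrib_right lookup_add) }
qed

lemma shuffle_word_Nil_right [simp]: "shuffle_word u [] = of_word u"
  by (cases u) auto

lemma lookup_shuffle_word:
  "Poly_Mapping.lookup (shuffle_word u v) w
     = shuf w (Poly_Mapping.lookup (of_word u)) (Poly_Mapping.lookup (of_word v))"
proof (induction w arbitrary: u v)
  case Nil
  show ?case
    by (cases u; cases v) (simp_all add: lookup_of_word lookup_add lookup_minus)
next
  case (Cons b w)
  have left: "(\<lambda>z. Poly_Mapping.lookup (of_word (a # s)) (b # z)) =
     (if a = b then Poly_Mapping.lookup (of_word s) else (\<lambda>z. 0))" for a s
    by (auto simp: lookup_of_word fun_eq_iff)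
  have left_at: "Poly_Mapping.lookup (of_word (a # s)) (b # w)
      = (if a = b then Poly_Mapping.lookup (of_word s) w else 0)" for a s
    by (simp add: lookup_of_word)
  have Nil_at: "Poly_Mapping.lookup (of_word []) (b # w) = 0"
    by (simp add: lookup_of_word)
  have Nil: "(\<lambda>z. Poly_Mapping.lookup (of_word []) (b # z)) = (\<lambda>z. 0)"
    by (simp add: lookup_of_word)
  have \<chi>: "(\<lambda>z. \<chi> b z * Poly_Mapping.lookup (of_word s) z) =
     (\<lambda>z. \<chi> b s * Poly_Mapping.lookup (of_word s) z)" for s
    by (auto simp: lookup_of_word fun_eq_iff)
  note shuffle_word_Cons = shuffle_word.simps(3)[unfolded braiding_factor]
  consider "u = []" | "v = []" | a s c z where "u = a # s" "v = c # z"
    by (metis list.exhaust)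
  then show ?case
  proof cases
    case 1
    then show ?thesis
      using Cons[of "[]" "tl v"] by (cases v) (auto simp: left left_at Nil Nil_at \<chi>)
  next
    case 2
    then show ?thesis
      using Cons[of "tl u" "[]"] by (cases u) (auto simp: left left_at Nil Nil_at \<chi>)
  next
    case 3
    have "Poly_Mapping.lookup (shuffle_word u v) (b # w) =
        (if a = b then Poly_Mapping.lookup (shuffle_word s v) w else 0)
      + (if c = b then \<chi> b u * Poly_Mapping.lookup (shuffle_word u z) w else 0)"
      by (simp add: 3 shuffle_word_Cons lookup_add del: shuffle_word.simps)
    then show ?thesis
      by (simp add: 3(1) left \<chi> Cons shuf_scale_left) (simp add: 3(2) left)
  qed
qed

text \<open>
  Both sides are bilinear, so this reduces to products of words.
\<close>
lemma lookup_star: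
  "Poly_Mapping.lookup (f \<star> g) = (\<lambda>w. shuf w (Poly_Mapping.lookup f) (Poly_Mapping.lookup g))"
proof
  fix w
  have expand: "Poly_Mapping.lookup h =
      (\<lambda>z. \<Sum>u\<in>Poly_Mapping.keys h. Poly_Mapping.lookup h u * Poly_Mapping.lookup (of_word u) z)"
    for h :: free_alg
    by (subst of_word_expansion) (simp add: lookup_sum fun_eq_iff)
  have "shuf w (Poly_Mapping.lookup f) (Poly_Mapping.lookup g) =
     (\<Sum>u\<in>Poly_Mapping.keys f. \<Sum>v\<in>Poly_Mapping.keys g.
        Poly_Mapping.lookup f u * Poly_Mapping.lookup g v * Poly_Mapping.lookup (shuffle_word u v) w)"
    by (subst (1) expand, subst (2) expand)
      (simp add: shuf_sum_left shuf_sum_right shuf_scale_left shuf_scale_right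
        lookup_shuffle_word sum_distrib_left mult.assoc)
  then show "Poly_Mapping.lookup (f \<star> g) w
      = shuf w (Poly_Mapping.lookup f) (Poly_Mapping.lookup g)"
    by (simp add: star_def lookup_sum)
qed

lemma star_assoc: "(f \<star> g) \<star> h = f \<star> (g \<star> h)"
  by (rule poly_mapping_eqI) (simp add: lookup_star shuf_assoc)

lemma star_add_left: "(f + f') \<star> g = f \<star> g + f' \<star> g"
  by (rule poly_mapping_eqI) (simp add: lookup_star plus_poly_mapping.rep_eq shuf_add_left)

lemma star_add_right: "f \<star> (g + g') = f \<star> g + f \<star> g'"
  by (rule poly_mapping_eqI) (simp add: lookup_star plus_poly_mapping.rep_eq shuf_add_right)

lemma star_scale_left: "(c \<odot> f) \<star> g = c \<odot> (f \<star> g)"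
  by (rule poly_mapping_eqI) (simp add: lookup_star lookup_scale_fun shuf_scale_left)

lemma star_scale_right: "f \<star> (c \<odot> g) = c \<odot> (f \<star> g)"
  by (rule poly_mapping_eqI) (simp add: lookup_star lookup_scale_fun shuf_scale_right)

lemma star_diff_left: "(f - f') \<star> g = f \<star> g - f' \<star> g"
  using star_add_left[of "f - f'" f' g] by (simp add: algebra_simps)

lemma star_diff_right: "f \<star> (g - g') = f \<star> g - f \<star> g'"
  using star_add_right[of f "g - g'" g'] by (simp add: algebra_simps)

lemma one_star [simp]: "1 \<star> f = f"
  by (induction f rule: free_alg_induct)
    (simp_all add: star_add_right star_scale_right star_of_word flip: of_word_Nil)

lemma star_one [simp]: "f \<star> 1 = f"
  by (induction f rule: free_alg_induct)
    (simp_all add: star_add_left star_scale_left star_of_word flip: of_word_Nil)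

lemma star_zero [simp]: "0 \<star> f = 0" "f \<star> 0 = 0"
  by (simp_all add: star_def)

lemma star_minus: "(- f) \<star> g = - (f \<star> g)" "f \<star> (- g) = - (f \<star> g)"
  using star_diff_left[of 0 f g] star_diff_right[of f 0 g] by simp_all

section \<open>Splitting off outer letters\<close>

definition has_height :: "int \<Rightarrow> free_alg \<Rightarrow> bool" where
  "has_height h f \<longleftrightarrow> (\<forall>w\<in>Poly_Mapping.keys f. height w = h)"

lemma has_height_of_word: "height w = h \<Longrightarrow> has_height h (of_word w)"
  by (simp add: has_height_def of_word_def)

lemma has_height_mult:
  "has_height h f \<Longrightarrow> has_height k g \<Longrightarrow> has_height (h + k) (f * g)"
  using keys_mult[of f g] by (fastforce simp: has_height_def plus_list_def)

text \<open>
  The defining recursion of the product on words extends to all elements, as long as the left factor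
  has one height, so that the braiding factor is a scalar.
\<close>
lemma star_concat_left:
  assumes "has_height h (of_word [a] * f)"
  shows "(of_word [a] * f) \<star> (of_word [b] * g) =
     of_word [a] * (f \<star> (of_word [b] * g))
     + \<tau> powi (wt b * h) \<odot> (of_word [b] * ((of_word [a] * f) \<star> g))"
proof (rule poly_mapping_eqI)
  fix w
  have \<chi>: "(\<lambda>u. \<chi> c u * Poly_Mapping.lookup (of_word [a] * f) u) =
    (\<lambda>u. \<tau> powi (wt c * h) * Poly_Mapping.lookup (of_word [a] * f) u)" for c
    using assms by (auto simp: fun_eq_iff has_height_def \<chi>_def in_keys_iff)
  show "Poly_Mapping.lookup ((of_word [a] * f) \<star> (of_word [b] * g)) w =
    Poly_Mapping.lookup (of_word [a] * (f \<star> (of_word [b] * g))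
     + \<tau> powi (wt b * h) \<odot> (of_word [b] * ((of_word [a] * f) \<star> g))) w"
    by (cases w) (auto simp: lookup_star lookup_add \<chi> shuf_scale_left)
qed

lemma star_concat_right:
  assumes "has_height h (g * of_word [b])"
  shows "(f * of_word [a]) \<star> (g * of_word [b]) =
     ((f * of_word [a]) \<star> g) * of_word [b]
     + \<tau> powi (wt a * h) \<odot> ((f \<star> (g * of_word [b])) * of_word [a])"
proof (rule poly_mapping_eqI)
  fix w
  have \<chi>: "(\<lambda>u. \<chi> c u * Poly_Mapping.lookup (g * of_word [b]) u) =
    (\<lambda>u. \<tau> powi (wt c * h) * Poly_Mapping.lookup (g * of_word [b]) u)" for c
    using assms by (auto simp: fun_eq_iff has_height_def \<chi>_def in_keys_iff)
  show "Poly_Mapping.lookup ((f * of_word [a]) \<star> (g * of_word [b])) w =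
    Poly_Mapping.lookup (((f * of_word [a]) \<star> g) * of_word [b]
     + \<tau> powi (wt a * h) \<odot> ((f \<star> (g * of_word [b])) * of_word [a])) w"
    by (cases w rule: rev_cases)
      (auto simp: lookup_star lookup_add shuf_snoc \<chi> shuf_scale_right)
qed

section \<open>The growth operators and the commutator with xy\<close>

text \<open>
  On a balanced word, this appends \<open>y\<close> and inserts one \<open>x\<close> at any place, with weights that
  depend on the height at that place (see \<open>grow_right_eq\<close>); \<open>grow_left\<close> is its mirror image.
\<close>
definition grow_right :: "free_alg \<Rightarrow> free_alg" where
  "grow_right v = \<tau> \<odot> (\<x> \<star> (v * \<y>)) - (v * \<y>) \<star> \<x>"

definition grow_left :: "free_alg \<Rightarrow> free_alg" where
  "grow_left v = \<tau> \<odot> ((\<x> * v) \<star> \<y>) - \<y> \<star> (\<x> * v)"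

lemma has_height_x [simp]: "has_height 1 \<x>" and has_height_y [simp]: "has_height (-1) \<y>"
  by (simp_all add: has_height_of_word)

lemma balanced_heights:
  assumes "has_height 0 v"
  shows "has_height 1 (\<x> * v)" "has_height (-1) (v * \<y>)" "has_height 0 (\<x> * v * \<y>)"
    "has_height 0 (\<x> * (v * \<y>))"
  using has_height_mult[OF has_height_x assms] has_height_mult[OF assms has_height_y]
    has_height_mult[OF has_height_mult[OF has_height_x assms] has_height_y]
  by (simp_all add: mult.assoc)

definition ad_xy :: "free_alg \<Rightarrow> free_alg" where
  "ad_xy f = f \<star> (\<x> * \<y>) - (\<x> * \<y>) \<star> f"

lemmas star_linear = star_add_left star_add_right star_diff_left star_diff_right
  star_scale_left star_scale_right star_minus

lemma grow_left_one: "grow_left 1 = (\<tau> - inverse \<tau>) \<odot> (\<x> * \<y>)"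
proof -
  have "\<x> \<star> \<y> = \<x> * \<y> + inverse \<tau> \<odot> (\<y> * \<x>)"
    and "\<y> \<star> \<x> = \<y> * \<x> + inverse \<tau> \<odot> (\<x> * \<y>)"
    using star_concat_left[of 1 X 1 Y 1] star_concat_left[of "-1" Y 1 X 1]
    by (simp_all add: power_int_minus)
  then show ?thesis
    by (simp add: grow_left_def free_alg.scale_right_distrib free_alg.scale_left_diff_distrib \<tau>_nonzero)
qed

lemma grow_right_one: "grow_right 1 = grow_left 1"
  by (simp add: grow_right_def grow_left_def)

text \<open>
  The terms in which \<open>x\<close> comes last cancel. This form is the recursion that defines the Catalan
  elements.
\<close>
lemma grow_right_eq:
  assumes "has_height 0 v"
  shows "grow_right v = (\<tau> \<odot> (\<x> \<star> v) - inverse \<tau> \<odot> (v \<star> \<x>)) * \<y>"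
proof -
  have "\<x> \<star> (v * \<y>) = (\<x> \<star> v) * \<y> + inverse \<tau> \<odot> (v * \<y> * \<x>)"
    and "(v * \<y>) \<star> \<x> = v * \<y> * \<x> + inverse \<tau> \<odot> ((v \<star> \<x>) * \<y>)"
    using star_concat_right[of "-1" v Y 1 X] star_concat_right[of 1 1 X v Y]
    by (simp_all add: assms balanced_heights power_int_minus)
  then show ?thesis
    by (simp add: grow_right_def free_alg.scale_right_distrib left_diff_distrib mult_scale_left \<tau>_nonzero)
qed

text \<open>
  This and \<open>y_commutator\<close> turn the growth operators into commutators with the single element
  \<open>x v y\<close>, so that associativity of \<open>\<star>\<close> can compare their compositions.
\<close>
lemma x_commutator:
  assumes "has_height 0 v"
  shows "\<x> \<star> (\<x> * v * \<y>) - (\<x> * v * \<y>) \<star> \<x> = \<x> * grow_right v"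
proof -
  have "\<x> \<star> (\<x> * (v * \<y>)) = \<x> * (\<x> * (v * \<y>)) + \<tau> \<odot> (\<x> * (\<x> \<star> (v * \<y>)))"
    and "(\<x> * (v * \<y>)) \<star> \<x> = \<x> * ((v * \<y>) \<star> \<x>) + \<x> * (\<x> * (v * \<y>))"
    using star_concat_left[of 1 X 1 X "v * \<y>"] star_concat_left[of 0 X "v * \<y>" X 1]
    by (simp_all add: assms balanced_heights)
  then show ?thesis
    by (simp add: grow_right_def mult.assoc right_diff_distrib mult_scale_right)
qed

lemma y_commutator:
  assumes "has_height 0 v"
  shows "(\<x> * v * \<y>) \<star> \<y> - \<y> \<star> (\<x> * v * \<y>) = grow_left v * \<y>"
proof -
  have "(\<x> * v * \<y>) \<star> \<y> = \<x> * v * \<y> * \<y> + \<tau> \<odot> (((\<x> * v) \<star> \<y>) * \<y>)"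
    and "\<y> \<star> (\<x> * v * \<y>) = (\<y> \<star> (\<x> * v)) * \<y> + \<x> * v * \<y> * \<y>"
    using star_concat_right[of "-1" 1 Y "\<x> * v" Y] star_concat_right[of 0 "\<x> * v" Y 1 Y]
    by (simp_all add: assms balanced_heights)
  then show ?thesis
    by (simp add: grow_left_def left_diff_distrib mult_scale_left)
qed

lemma ad_xy_concat_x:
  assumes "has_height 0 v"
  shows "ad_xy (\<x> * v) = \<x> * (grow_left v + ad_xy v)"
proof -
  have "(\<x> * v) \<star> (\<x> * \<y>) = \<x> * (v \<star> (\<x> * \<y>)) + \<tau> \<odot> (\<x> * ((\<x> * v) \<star> \<y>))"
    and "(\<x> * \<y>) \<star> (\<x> * v) = \<x> * (\<y> \<star> (\<x> * v)) + \<x> * ((\<x> * \<y>) \<star> v)"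
    using star_concat_left[of 1 X v X \<y>] star_concat_left[of 0 X \<y> X v]
      has_height_mult[OF has_height_x has_height_y]
    by (simp_all add: assms balanced_heights)
  then show ?thesis
    by (simp add: grow_left_def ad_xy_def distrib_left right_diff_distrib mult_scale_right)
qed

lemma ad_xy_concat_y:
  assumes "has_height 0 v"
  shows "ad_xy (v * \<y>) = (ad_xy v - grow_right v) * \<y>"
proof -
  have "(\<x> * \<y>) \<star> (v * \<y>) = ((\<x> * \<y>) \<star> v) * \<y> + \<tau> \<odot> ((\<x> \<star> (v * \<y>)) * \<y>)"
    and "(v * \<y>) \<star> (\<x> * \<y>) = ((v * \<y>) \<star> \<x>) * \<y> + (v \<star> (\<x> * \<y>)) * \<y>"
    using star_concat_right[of "-1" v Y \<x> Y] star_concat_right[of 0 \<x> Y v Y]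
      has_height_mult[OF has_height_x has_height_y]
    by (simp_all add: assms balanced_heights)
  then show ?thesis
    by (simp add: grow_right_def ad_xy_def distrib_right left_diff_distrib mult_scale_left)
qed

text \<open>
  Splitting off the first letters leaves the commutators of \<open>v y\<close> with \<open>x y\<close> and of \<open>x v y\<close>
  with \<open>y\<close>, in which the two growth operators appear with opposite signs. So \<open>x v y\<close> commutes
  with \<open>x y\<close> if \<open>v\<close> does and the growth operators agree at \<open>v\<close>.
\<close>
lemma ad_xy_concat_xy:
  assumes "has_height 0 v"
  shows "ad_xy (\<x> * v * \<y>) = \<x> * ((grow_left v - grow_right v + ad_xy v) * \<y>)"
proof -
  have "(\<x> * (v * \<y>)) \<star> (\<x> * \<y>) = \<x> * ((v * \<y>) \<star> (\<x> * \<y>)) + \<x> * ((\<x> * (v * \<y>)) \<star> \<y>)"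
    and "(\<x> * \<y>) \<star> (\<x> * (v * \<y>)) = \<x> * (\<y> \<star> (\<x> * (v * \<y>))) + \<x> * ((\<x> * \<y>) \<star> (v * \<y>))"
    using star_concat_left[of 0 X "v * \<y>" X \<y>] star_concat_left[of 0 X \<y> X "v * \<y>"]
      has_height_mult[OF has_height_x has_height_y]
    by (simp_all add: assms balanced_heights)
  then have "ad_xy (\<x> * v * \<y>)
      = \<x> * (ad_xy (v * \<y>) + ((\<x> * v * \<y>) \<star> \<y> - \<y> \<star> (\<x> * v * \<y>)))"
    by (simp add: ad_xy_def mult.assoc distrib_left right_diff_distrib)
  also have "\<dots> = \<x> * ((grow_left v - grow_right v + ad_xy v) * \<y>)"
    by (simp only: ad_xy_concat_y[OF assms] y_commutator[OF assms]) (simp add: algebra_simps)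
  finally show ?thesis .
qed

text \<open>
  By \<open>x_commutator\<close> and \<open>y_commutator\<close>, both compositions are combinations of products of
  \<open>x\<close>, \<open>y\<close> and \<open>z = x v y\<close> in the associative shuffle algebra. In the difference only
  the commutator of \<open>z\<close> with \<open>grow_left 1\<close> survives, and \<open>grow_left 1\<close> is a multiple of \<open>x y\<close>.
\<close>
lemma grow_right_grow_left_commute:
  assumes "has_height 0 v"
  shows "grow_right (grow_left v) - grow_left (grow_right v) = (\<tau> - inverse \<tau>) \<odot> ad_xy (\<x> * v * \<y>)"
proof -
  define z where "z = \<x> * v * \<y>"
  have "grow_right (grow_left v) = \<tau> \<odot> (\<x> \<star> (z \<star> \<y> - \<y> \<star> z)) - (z \<star> \<y> - \<y> \<star> z) \<star> \<x>"
    unfolding grow_right_def[of "grow_left v"] y_commutator[OF assms, folded z_def, symmetric] ..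
  moreover have "grow_left (grow_right v) = \<tau> \<odot> ((\<x> \<star> z - z \<star> \<x>) \<star> \<y>) - \<y> \<star> (\<x> \<star> z - z \<star> \<x>)"
    unfolding grow_left_def[of "grow_right v"] x_commutator[OF assms, folded z_def, symmetric] ..
  ultimately have "grow_right (grow_left v) - grow_left (grow_right v) = z \<star> grow_left 1 - grow_left 1 \<star> z"
    by (simp add: grow_left_def star_linear star_assoc free_alg.scale_right_diff_distrib)
  then show ?thesis
    by (simp add: grow_left_one ad_xy_def z_def star_linear free_alg.scale_right_diff_distrib)
qed

lemma ad_xy_star: "ad_xy (f \<star> g) = ad_xy f \<star> g + f \<star> ad_xy g"
  by (simp add: ad_xy_def star_linear star_assoc)

lemma ad_xy_diff: "ad_xy (f - g) = ad_xy f - ad_xy g"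
  by (simp add: ad_xy_def star_linear)

lemma ad_xy_scale: "ad_xy (c \<odot> f) = c \<odot> ad_xy f"
  by (simp add: ad_xy_def star_linear free_alg.scale_right_diff_distrib)

lemma ad_xy_one: "ad_xy 1 = 0"
  by (simp add: ad_xy_def)

section \<open>The recursion of the Catalan elements\<close>

definition \<kappa> :: scalar where "\<kappa> = q + inverse q"

lemma \<kappa>_nonzero [simp]: "\<kappa> \<noteq> 0"
  by (simp add: \<kappa>_def q_plus_inverse_nonzero)

lemma \<tau>_powi: "\<tau> powi m = (-1) powi m * q powi (2 * m)"
proof -
  have "\<tau> = (-1) * q powi 2"
    by (simp add: \<tau>_def)
  then have "\<tau> powi m = (-1) powi m * (q powi 2) powi m"
    by (metis power_int_mult_distrib)
  then show ?thesis
    by (simp only: power_int_mult)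
qed

lemma qbracket_even:
  assumes "even h \<longleftrightarrow> even i"
  shows "(-1) ^ i * qbracket (2 + 2 * h) = (\<tau> powi (1 + h) - inverse \<tau> * \<tau> powi (- h)) / \<kappa>"
proof -
  \<comment> \<open>The sign \<open>(-1) ^ i\<close> in the recursion is the sign in \<open>\<tau> = - q\<^sup>2\<close>,
    as position and height have equal parity.\<close>
  have sign: "(-1 :: scalar) powi (1 + h) = - ((-1) ^ i)" "(-1 :: scalar) powi (- (1 + h)) = - ((-1) ^ i)"
    "(-1 :: scalar) powi (2 + 2 * h) = 1"
    using assms by (auto simp: power_int_minus_left)
  have "inverse \<tau> * \<tau> powi (- h) = \<tau> powi (- (1 + h))"
    using \<tau>_powi_add[of "-1" "-h"] by (simp add: power_int_minus)
  then have "\<tau> powi (1 + h) - inverse \<tau> * \<tau> powi (- h)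
      = - ((-1) ^ i) * q powi (2 + 2 * h) + (-1) ^ i * q powi (- (2 + 2 * h))"
    by (simp only: \<tau>_powi sign) (simp add: algebra_simps)
  also have "\<dots> = (-1) ^ i * (q powi (- (2 + 2 * h)) - (-1) powi (2 + 2 * h) * q powi (2 + 2 * h))"
    unfolding sign by (simp add: algebra_simps)
  finally show ?thesis
    by (simp add: qbracket_def \<kappa>_def)
qed

lemma parity_height: "even (height w) \<longleftrightarrow> even (length w)"
proof (induction w)
  case (Cons a w)
  then show ?case by (cases a) auto
qed simp

definition insert_x :: "nat \<Rightarrow> word \<Rightarrow> word" where
  "insert_x i v = take i v @ [X] @ drop i v"

lemma x_star_word:
  "\<x> \<star> of_word v = (\<Sum>i\<le>length v. \<tau> powi height (take i v) \<odot> of_word (insert_x i v))"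
proof (induction v)
  case Nil
  show ?case by (simp add: insert_x_def star_of_word)
next
  case (Cons b v)
  have shift: "(\<Sum>i\<le>length v. \<tau> powi height (take (Suc i) (b # v)) \<odot> of_word (insert_x (Suc i) (b # v)))
      = \<tau> powi wt b \<odot> (of_word [b] * (\<x> \<star> of_word v))"
    unfolding Cons
    by (simp add: insert_x_def \<tau>_powi_add sum_distrib_left free_alg.scale_sum_right mult_scale_right
      flip: of_word_append)
  have "\<x> \<star> of_word (b # v) = \<x> * of_word (b # v) + \<tau> powi wt b \<odot> (of_word [b] * (\<x> \<star> of_word v))"
    using star_concat_left[of 1 X 1 b "of_word v"] by (simp flip: of_word_append)
  then show ?case
    by (simp add: sum.atMost_Suc_shift insert_x_def del: sum.atMost_Suc flip: shift of_word_append)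
qed

lemma word_star_x:
  "of_word v \<star> \<x> = (\<Sum>i\<le>length v. \<tau> powi height (drop i v) \<odot> of_word (insert_x i v))"
proof (induction v)
  case Nil
  show ?case by (simp add: insert_x_def star_of_word)
next
  case (Cons b v)
  have shift: "(\<Sum>i\<le>length v. \<tau> powi height (drop (Suc i) (b # v)) \<odot> of_word (insert_x (Suc i) (b # v)))
      = of_word [b] * (of_word v \<star> \<x>)"
    unfolding Cons
    by (simp add: insert_x_def sum_distrib_left mult_scale_right flip: of_word_append)
  have "of_word (b # v) \<star> \<x>
      = of_word [b] * (of_word v \<star> \<x>) + \<tau> powi height (b # v) \<odot> (\<x> * of_word (b # v))"
    using star_concat_left[of "height (b # v)" b "of_word v" X 1]
    by (simp add: has_height_of_word flip: of_word_append)
  then show ?case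
    by (simp add: sum.atMost_Suc_shift insert_x_def del: sum.atMost_Suc flip: shift of_word_append)
qed

lemma catalan_iff: "catalan w \<longleftrightarrow> height w = 0 \<and> (\<forall>i. height (take i w) \<ge> 0)"
proof -
  have "height (take i w) \<ge> 0" if "height w = 0" "\<forall>i\<in>{1..length w}. height (take i w) \<ge> 0" for i
    using that by (cases "i = 0"; cases "i \<le> length w") auto
  then show ?thesis
    unfolding catalan_def by blast
qed

text \<open>
  Inserting \<open>x\<close> raises all later heights by one, which leaves room for the final \<open>y\<close>.
\<close>
lemma insert_x_Cat:
  assumes "v \<in> Cat n" "i \<le> length v"
  shows "insert_x i v @ [Y] \<in> Cat (Suc n)"
proof -
  have v: "height v = 0" "height (take j v) \<ge> 0" "length v = 2 * n" for j
    using assms by (auto simp: Cat_def catalan_iff)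
  have split: "height (take i v) + height (drop i v) = 0"
    using v(1) height_simps(3)[of "take i v" "drop i v"] by simp
  have "height (take j (insert_x i v @ [Y])) \<ge> 0" for j
  proof -
    consider "j \<le> i" | "i < j" "j \<le> Suc (length v)" | "Suc (length v) < j"
      by linarith
    then show ?thesis
    proof cases
      case 1
      then show ?thesis
        using assms v(2)[of j] by (simp add: insert_x_def min_absorb1)
    next
      case 2
      then obtain d where d: "j = Suc (i + d)"
        using less_imp_Suc_add by blast
      then have "take j (insert_x i v @ [Y]) = take i v @ X # take d (drop i v)"
        using assms 2 by (simp add: insert_x_def)
      then show ?thesis
        using v(2)[of "i + d"] by (simp add: take_add)
    next
      case 3
      then show ?thesis
        using assms split by (simp add: insert_x_def)
    qed
  qed
  moreover have "height (insert_x i v @ [Y]) = 0"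
    using split by (simp add: insert_x_def)
  moreover have "length (insert_x i v @ [Y]) = 2 * Suc n"
    using v assms by (simp add: insert_x_def)
  ultimately show ?thesis
    by (simp add: Cat_def catalan_iff)
qed

lemma has_height_Cs: "has_height 0 (Cs n)"
proof -
  have "Poly_Mapping.lookup (Cs n) w = 0" if "height w \<noteq> 0" for w
    using that by (auto simp: Cs_def lookup_sum lookup_of_word Cat_def catalan_def intro!: sum.neutral)
  then show ?thesis
    unfolding has_height_def by (auto simp: in_keys_iff)
qed

text \<open>
  For a balanced word, the weights of \<open>x \<star> v\<close> and \<open>v \<star> x\<close> at a place are inverse to each other,
  and \<open>qbracket_even\<close> identifies their combination with the weight in the recursion.
\<close>
lemma grow_right_Cs: "grow_right (Cs n) = \<kappa> \<odot> Cs (Suc n)"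
proof -
  define c where "c v i = \<tau> powi (1 + height (take i v)) - inverse \<tau> * \<tau> powi (- height (take i v))"
    for v :: word and i
  have word: "(\<tau> \<odot> (\<x> \<star> of_word v) - inverse \<tau> \<odot> (of_word v \<star> \<x>)) * \<y>
      = (\<Sum>i\<le>length v. c v i \<odot> of_word (insert_x i v @ [Y]))" if "v \<in> Cat n" for v
  proof -
    have "height (drop i v) = - height (take i v)" for i
      using that height_simps(3)[of "take i v" "drop i v"] by (simp add: Cat_def catalan_def)
    then show ?thesis
      by (simp add: x_star_word word_star_x c_def free_alg.scale_sum_right free_alg.scale_left_diff_distrib
          \<tau>_powi_add sum_subtractf left_diff_distrib sum_distrib_right mult_scale_left of_word_append
          mult.assoc)
  qed
  have coeff: "\<kappa> * (\<Sum>i\<in>{i. i \<le> length v \<and> w = take i v @ [X] @ drop i v @ [Y]}.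
           (-1) ^ i * qbracket (2 + 2 * height (take i v)))
      = (\<Sum>i\<le>length v. if w = insert_x i v @ [Y] then c v i else 0)" for v w
  proof -
    have "(-1) ^ i * qbracket (2 + 2 * height (take i v)) = c v i / \<kappa>" if "i \<le> length v" for i
      unfolding c_def by (rule qbracket_even) (use that in \<open>simp add: parity_height min_absorb2\<close>)
    then show ?thesis
      by (auto simp: sum.If_cases sum_distrib_left insert_x_def Int_def intro!: sum.cong)
  qed
  have coeff': "\<kappa> * (a * (\<Sum>i\<in>{i. i \<le> length v \<and> w = take i v @ [X] @ drop i v @ [Y]}.
           (-1) ^ i * qbracket (2 + 2 * height (take i v))))
      = (\<Sum>i\<le>length v. if w = insert_x i v @ [Y] then a * c v i else 0)" for a v w
    unfolding mult.left_commute[of \<kappa> a] coeff by (simp add: sum_distrib_left if_distrib cong: if_cong)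
  have "\<kappa> \<odot> Cs (Suc n) = (\<Sum>w\<in>Cat (Suc n). (\<Sum>v\<in>Cat n. \<Sum>i\<le>length v.
      if w = insert_x i v @ [Y] then Cs_coeff n v * c v i else 0) \<odot> of_word w)"
    unfolding Cs_def free_alg.scale_sum_right free_alg.scale_scale
    by (simp only: Cs_coeff.simps sum_distrib_left[of \<kappa> _ "Cat n"] coeff')
  also have "\<dots> = (\<Sum>v\<in>Cat n. \<Sum>i\<le>length v. \<Sum>w\<in>Cat (Suc n).
      if w = insert_x i v @ [Y] then (Cs_coeff n v * c v i) \<odot> of_word w else 0)"
    unfolding free_alg.scale_sum_left
    by (subst sum.swap, rule sum.cong[OF refl], subst sum.swap) (auto intro!: sum.cong)
  also have "\<dots> = (\<Sum>v\<in>Cat n. \<Sum>i\<le>length v. (Cs_coeff n v * c v i) \<odot> of_word (insert_x i v @ [Y]))"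
    by (intro sum.cong refl) (simp add: sum.delta finite_Cat insert_x_Cat del: append.simps)
  also have "\<dots> = (\<Sum>v\<in>Cat n. Cs_coeff n v \<odot>
      ((\<tau> \<odot> (\<x> \<star> of_word v) - inverse \<tau> \<odot> (of_word v \<star> \<x>)) * \<y>))"
    by (intro sum.cong refl) (simp only: word free_alg.scale_sum_right free_alg.scale_scale)
  also have "\<dots> = (\<tau> \<odot> (\<x> \<star> Cs n) - inverse \<tau> \<odot> (Cs n \<star> \<x>)) * \<y>"
  proof -
    have 1: "f \<star> (\<Sum>v\<in>A. g v) = (\<Sum>v\<in>A. f \<star> g v)" "(\<Sum>v\<in>A. g v) \<star> f = (\<Sum>v\<in>A. g v \<star> f)"
      if "finite A" for f and g :: "word \<Rightarrow> free_alg" and A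
      using that by (induction A rule: finite_induct) (auto simp: star_linear)
    show ?thesis
      by (simp add: Cs_def 1 finite_Cat star_linear free_alg.scale_sum_right mult_scale_left
        sum_distrib_right sum_subtractf left_diff_distrib free_alg.scale_right_diff_distrib mult.commute)
  qed
  finally show ?thesis
    by (simp add: grow_right_eq has_height_Cs)
qed

lemma grow_right_scale: "grow_right (c \<odot> v) = c \<odot> grow_right v"
  and grow_left_scale: "grow_left (c \<odot> v) = c \<odot> grow_left v"
  by (simp_all add: grow_right_def grow_left_def mult_scale_left mult_scale_right star_linear
      free_alg.scale_right_diff_distrib mult.commute)

section \<open>Symmetry and commutation of the Catalan elements\<close>

definition cross :: "nat \<Rightarrow> nat \<Rightarrow> free_alg" where
  "cross k l = \<tau> \<odot> ((\<x> * Cs l) \<star> (Cs k * \<y>)) - (Cs k * \<y>) \<star> (\<x> * Cs l)"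

text \<open>
  The two halves support each other: commutation of the growth operators at \<open>Cs m\<close>
  uses that \<open>Cs m\<close> commutes with \<open>x y\<close>, and commutation of \<open>Cs n\<close> with \<open>x y\<close> comes from
  equating the two ends of a diagonal of \<open>cross\<close>, which are the values of the growth operators
  at \<open>Cs n\<close>.
\<close>
lemma grow_left_Cs_and_ad_xy_Cs: "grow_left (Cs n) = \<kappa> \<odot> Cs (Suc n) \<and> ad_xy (Cs n) = 0"
proof (induction n rule: less_induct)
  case (less n)
  show ?case
  proof (cases n)
    case 0
    then show ?thesis
      using grow_right_Cs[of 0] by (simp add: Cs_0 ad_xy_one grow_right_one)
  next
    case (Suc m)
    have IH: "grow_left (Cs j) = \<kappa> \<odot> Cs (Suc j)" "ad_xy (Cs j) = 0" if "j \<le> m" for j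
      using less[of j] that Suc by simp_all
    have "grow_right (grow_left (Cs m)) = grow_left (grow_right (Cs m))"
      using grow_right_grow_left_commute[OF has_height_Cs, of m]
      by (simp add: ad_xy_concat_xy has_height_Cs IH grow_right_Cs)
    then have "\<kappa> \<odot> grow_left (Cs n) = \<kappa> \<odot> (\<kappa> \<odot> Cs (Suc n))"
      by (simp add: IH grow_right_Cs grow_right_scale grow_left_scale Suc)
    then have left: "grow_left (Cs n) = \<kappa> \<odot> Cs (Suc n)"
      by (simp del: free_alg.scale_scale)
    have ad_cross: "ad_xy (cross k l) = \<kappa> \<odot> (cross k (Suc l) - cross (Suc k) l)"
      if "k \<le> m" "l \<le> m" for k l
    proof -
      have "ad_xy (\<x> * Cs l) = \<kappa> \<odot> (\<x> * Cs (Suc l))" "ad_xy (Cs k * \<y>) = - (\<kappa> \<odot> (Cs (Suc k) * \<y>))"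
        using that
        by (simp_all add: ad_xy_concat_x ad_xy_concat_y has_height_Cs IH grow_right_Cs
            mult_scale_left mult_scale_right)
      then show ?thesis
        by (simp add: cross_def ad_xy_diff ad_xy_scale ad_xy_star star_linear free_alg.scale_right_diff_distrib
            free_alg.scale_right_distrib mult.commute)
    qed
    have cross_0: "cross k 0 = \<kappa> \<odot> Cs (Suc k)" for k
      using grow_right_Cs[of k] by (simp add: cross_def grow_right_def Cs_0)
    \<comment> \<open>On a known diagonal the entries have zero \<open>ad_xy\<close>, hence the next diagonal is constant.\<close>
    have cross_eq: "cross k l = \<kappa> \<odot> Cs (Suc (k + l))" if "k + l \<le> m" for k l
      using that
    proof (induction l arbitrary: k)
      case 0
      show ?case using cross_0 by simp
    next
      case (Suc l)
      have "\<kappa> \<odot> (cross k (Suc l) - cross (Suc k) l) = \<kappa> \<odot> 0"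
        using ad_cross[of k l] Suc IH(2)[of "Suc (k + l)"] by (simp add: ad_xy_scale)
      then have "cross k (Suc l) - cross (Suc k) l = 0"
        by (simp del: free_alg.scale_scale)
      then have "cross k (Suc l) = cross (Suc k) l"
        by simp
      then show ?case
        using Suc.IH[of "Suc k"] Suc.prems by simp
    qed
    \<comment> \<open>One diagonal further, neighbours differ by the constant \<open>ad_xy (Cs n)\<close>.\<close>
    have step: "cross k (Suc m - k) = cross (Suc k) (m - k) + ad_xy (Cs n)" if "k \<le> m" for k
    proof -
      have "\<kappa> \<odot> (cross k (Suc (m - k)) - cross (Suc k) (m - k)) = \<kappa> \<odot> ad_xy (Cs n)"
        using ad_cross[of k "m - k"] cross_eq[of k "m - k"] that by (simp add: ad_xy_scale Suc)
      then have "cross k (Suc (m - k)) - cross (Suc k) (m - k) = ad_xy (Cs n)"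
        by (simp del: free_alg.scale_scale)
      then show ?thesis
        using that by (simp add: Suc_diff_le algebra_simps)
    qed
    have "cross 0 (Suc m) = cross k (Suc m - k) + of_nat k \<odot> ad_xy (Cs n)" if "k \<le> Suc m" for k
      using that
    proof (induction k)
      case (Suc k)
      then show ?case
        using step[of k] by (simp add: free_alg.scale_left_distrib algebra_simps)
    qed simp
    from this[of "Suc m"] have "cross 0 (Suc m) = cross (Suc m) 0 + of_nat (Suc m) \<odot> ad_xy (Cs n)"
      by simp
    moreover have "cross 0 (Suc m) = \<kappa> \<odot> Cs (Suc n)"
      using left by (simp add: cross_def grow_left_def Cs_0 Suc)
    ultimately have "of_nat (Suc m) \<odot> ad_xy (Cs n) = 0"
      using cross_0[of "Suc m"] Suc by simp
    then have "ad_xy (Cs n) = 0"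
      by (simp del: of_nat_Suc add: of_nat_neq_0)
    with left show ?thesis by blast
  qed
qed

section \<open>The relations\<close>

theorem corollary60:
  fixes k l :: nat
  shows "\<x> * Cs (k + l + 1) =
           inverse (q + inverse q) \<odot>
             ((\<x> * Cs l) \<star> (\<x> * Cs k * \<y>) - (\<x> * Cs k * \<y>) \<star> (\<x> * Cs l)) \<and>
         Cs (k + l + 1) * \<y> =
           inverse (q + inverse q) \<odot>
             ((\<x> * Cs k * \<y>) \<star> (Cs l * \<y>) - (Cs l * \<y>) \<star> (\<x> * Cs k * \<y>))"
proof -
  define z where "z = \<x> * Cs k * \<y>"
  have ad_z: "ad_xy z = 0"
    by (simp add: z_def ad_xy_concat_xy has_height_Cs grow_left_Cs_and_ad_xy_Cs grow_right_Cs)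
  have ad_x: "ad_xy (\<x> * Cs l) = \<kappa> \<odot> (\<x> * Cs (Suc l))" for l
    by (simp add: ad_xy_concat_x has_height_Cs grow_left_Cs_and_ad_xy_Cs mult_scale_right)
  have ad_y: "ad_xy (Cs l * \<y>) = - (\<kappa> \<odot> (Cs (Suc l) * \<y>))" for l
    by (simp add: ad_xy_concat_y has_height_Cs grow_left_Cs_and_ad_xy_Cs grow_right_Cs mult_scale_left)
  have x: "(\<x> * Cs l) \<star> z - z \<star> (\<x> * Cs l) = \<kappa> \<odot> (\<x> * Cs (Suc (k + l)))"
  proof (induction l)
    case 0
    show ?case
      using x_commutator[OF has_height_Cs, of k]
      by (simp add: Cs_0 z_def grow_right_Cs mult_scale_right)
  next
    case (Suc l)
    have "\<kappa> \<odot> ((\<x> * Cs (Suc l)) \<star> z - z \<star> (\<x> * Cs (Suc l)))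
        = ad_xy ((\<x> * Cs l) \<star> z - z \<star> (\<x> * Cs l))"
      by (simp add: ad_xy_diff ad_xy_star ad_x ad_z star_linear
          free_alg.scale_right_diff_distrib)
    also have "\<dots> = \<kappa> \<odot> (\<kappa> \<odot> (\<x> * Cs (Suc (Suc (k + l)))))"
      by (simp add: Suc ad_xy_scale ad_x)
    finally show ?case
      by (simp del: free_alg.scale_scale)
  qed
  have y: "z \<star> (Cs l * \<y>) - (Cs l * \<y>) \<star> z = \<kappa> \<odot> (Cs (Suc (k + l)) * \<y>)"
  proof (induction l)
    case 0
    show ?case
      using y_commutator[OF has_height_Cs, of k]
      by (simp add: Cs_0 z_def grow_left_Cs_and_ad_xy_Cs mult_scale_left)
  next
    case (Suc l)
    have "\<kappa> \<odot> (z \<star> (Cs (Suc l) * \<y>) - (Cs (Suc l) * \<y>) \<star> z)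
        = - ad_xy (z \<star> (Cs l * \<y>) - (Cs l * \<y>) \<star> z)"
      by (simp add: ad_xy_diff ad_xy_star ad_y ad_z star_linear
          free_alg.scale_right_diff_distrib)
    also have "\<dots> = \<kappa> \<odot> (\<kappa> \<odot> (Cs (Suc (Suc (k + l))) * \<y>))"
      by (simp add: Suc ad_xy_scale ad_y)
    finally show ?case
      by (simp del: free_alg.scale_scale)
  qed
  show ?thesis
    using x y \<kappa>_nonzero unfolding z_def by (simp flip: \<kappa>_def)
qed

end
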